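(* Let $I\subseteq\mathbb{R}$ be a non-empty open interval and let $t\in(0,1)$ be fixed. If $f:I\to\mathbb{R}$ is non-symmetrically $t$-affine, then $f$ is $t$-affine.
   Context: Intervals are not required to be bounded. A function $f:I\to\mathbb{R}$ is called non-symmetrically $t$-affine if $f(tx+(1-t)y)=tf(x)+(1-t)f(y)$ for all $x,y\in I$ with $x\leq y$. It is called $t$-affine if $f(tx+(1-t)y)=tf(x)+(1-t)f(y)$ for all $x,y\in I$ (no order restriction on $x,y$). *)

theory Defs
  imports "HOL-Analysis.Analysis"
begin

(* Functions f : I \<rightarrow> \<real> are represented by total functions real \<Rightarrow> real of which only the
   values on I matter: for an interval I and 0 < t < 1 the point t * x + (1 - t) * y
   lies in I whenever x and y do. *)

definition nonsym_t_affine_on :: "real \<Rightarrow> real set \<Rightarrow> (real \<Rightarrow> real) \<Rightarrow> bool" where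
  "nonsym_t_affine_on t I f \<longleftrightarrow>
     (\<forall>x\<in>I. \<forall>y\<in>I. x \<le> y \<longrightarrow> f (t * x + (1 - t) * y) = t * f x + (1 - t) * f y)"

definition t_affine_on :: "real \<Rightarrow> real set \<Rightarrow> (real \<Rightarrow> real) \<Rightarrow> bool" where
  "t_affine_on t I f \<longleftrightarrow>
     (\<forall>x\<in>I. \<forall>y\<in>I. f (t * x + (1 - t) * y) = t * f x + (1 - t) * f y)"

end

theory Submission
  imports Defs
begin

text \<open>
  Write \<open>p = 1 - t\<close>. The two points \<open>t * a + p * b\<close> and \<open>t * b + p * a\<close> are mirror images of each
  other in the midpoint of \<open>a\<close> and \<open>b\<close>. Hence, if \<open>f\<close> satisfies the Jensen equation
  \<open>f (x - k) + f (x + k) = 2 * f x\<close>, then the affine equation for the ordered pair \<open>a \<le> b\<close> yields the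
  one for the reversed pair, so it is enough to prove the Jensen equation.

  For reflections that are short compared with the room on the right of \<open>x\<close>, it comes from affine
  extrapolation (\<open>nonsym_t_affine_short_reflection\<close>): on \<open>x < x + h\<close> the hypothesis determines
  \<open>f\<close> at the points with parameters \<open>p^2\<close> and \<open>2 * p - p^2\<close> as the affine
  interpolation, and \<open>p^2\<close> is the weighted mean, in the admissible order, of \<open>-p^2\<close> and
  \<open>2 * p - p^2\<close>; so \<open>f\<close> is also affine at \<open>-p^2\<close>.

  Short reflections are then enlarged (\<open>nonsym_t_affine_Jensen\<close>) by homogeneity. The increment of
  \<open>f\<close> at \<open>x\<close> scales by \<open>p\<close> on the right and by \<open>t\<close> on the left. Short reflections carry the factor
  \<open>t\<close> over to small right increments, and the factor \<open>p\<close> spreads it to all right increments. Since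
  the increments on both sides now scale by \<open>t\<close>, oddness for small arguments gives oddness for all.
\<close>

lemma nonsym_t_affine_onD:
  assumes "nonsym_t_affine_on t I f" "x \<in> I" "y \<in> I" "x \<le> y"
  shows "f (t * x + (1 - t) * y) = t * f x + (1 - t) * f y"
  using assms unfolding nonsym_t_affine_on_def by blast

lemma nonsym_t_affine_right_increment:
  assumes "nonsym_t_affine_on t I f" "x \<in> I" "x + h \<in> I" "0 \<le> h"
  shows "f (x + (1 - t) * h) - f x = (1 - t) * (f (x + h) - f x)"
proof -
  have "t * x + (1 - t) * (x + h) = x + (1 - t) * h"
    by (simp add: algebra_simps)
  then show ?thesis
    using nonsym_t_affine_onD[OF assms(1-3)] assms(4) by (simp add: algebra_simps)
qed

lemma nonsym_t_affine_left_increment: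
  assumes "nonsym_t_affine_on t I f" "x \<in> I" "x - h \<in> I" "0 \<le> h"
  shows "f (x - t * h) - f x = t * (f (x - h) - f x)"
proof -
  have "t * (x - h) + (1 - t) * x = x - t * h"
    by (simp add: algebra_simps)
  then show ?thesis
    using nonsym_t_affine_onD[OF assms(1,3,2)] assms(4) by (simp add: algebra_simps)
qed

text \<open>
  The two sides of \<open>x\<close> communicate because the hypothesis can be solved for the value at the
  \<^emph>\<open>left\<close> endpoint: once \<open>f\<close> is known to be affine at an interior point and at the right endpoint, it
  is so at a point that may lie to the left of \<open>x\<close>.
\<close>

lemma nonsym_t_affine_short_reflection:
  assumes aff: "nonsym_t_affine_on t I f" and I: "is_interval I" and t: "0 < t" "t < 1"
    and h: "0 \<le> h" and right: "x + h \<in> I" and left: "x - (1 - t)^2 * h \<in> I"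
  shows "f (x - (1 - t)^2 * h) + f (x + (1 - t)^2 * h) = 2 * f x"
proof -
  define p where "p = 1 - t"
  have p: "0 < p" "p < 1" and tp: "t = 1 - p"
    using t by (auto simp: p_def)
  have p2: "p^2 * h \<ge> 0" "p^2 * h \<le> p * h" "p * h \<le> h"
    using p h by (auto simp: power2_eq_square mult_left_le_one_le mult_right_mono)
  have I_mem: "z \<in> I" if "x - p^2 * h \<le> z" "z \<le> x + h" for z
    using mem_is_interval_1_I[OF I left right] that by (simp add: p_def)
  define G where "G = f (x + h) - f x"
  have f1: "f (x + p * h) = f x + p * G"
    using nonsym_t_affine_right_increment[OF aff, of x h] I_mem p2 right h
    by (simp add: p_def G_def)
  have f2: "f (x + p^2 * h) = f x + p^2 * G"
    using nonsym_t_affine_right_increment[OF aff, of x "p * h"] I_mem p2 f1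
    by (simp add: power2_eq_square algebra_simps flip: p_def)
  have "t * (x + p * h) + (1 - t) * (x + h) = x + (2 * p - p^2) * h"
    unfolding tp by (simp add: algebra_simps power2_eq_square)
  then have "f (x + (2 * p - p^2) * h) = t * f (x + p * h) + p * f (x + h)"
    using nonsym_t_affine_onD[OF aff, of "x + p * h" "x + h"] I_mem p2 by (simp add: p_def)
  then have f3: "f (x + (2 * p - p^2) * h) = f x + (2 * p - p^2) * G"
    unfolding f1 tp by (simp add: G_def algebra_simps power2_eq_square)
  have "(2 * p - p^2) * h \<ge> 0" "(2 * p - p^2) * h \<le> h"
  proof -
    show "(2 * p - p^2) * h \<ge> 0"
      using p2 by (simp add: algebra_simps)
    have "0 \<le> (1 - p)^2 * h"
      using h by simp
    then show "(2 * p - p^2) * h \<le> h"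
      by (simp add: algebra_simps power2_eq_square)
  qed
  then have "x + (2 * p - p^2) * h \<in> I" "x - p^2 * h \<le> x + (2 * p - p^2) * h"
    using I_mem[of "x + (2 * p - p^2) * h"] p2(1) by linarith+
  moreover have "t * (x - p^2 * h) + (1 - t) * (x + (2 * p - p^2) * h) = x + p^2 * h"
    unfolding tp by (simp add: algebra_simps power2_eq_square)
  ultimately have "f (x + p^2 * h) = t * f (x - p^2 * h) + p * f (x + (2 * p - p^2) * h)"
    using nonsym_t_affine_onD[OF aff, of "x - p^2 * h" "x + (2 * p - p^2) * h"] left
    by (simp flip: p_def)
  then have "t * (f (x - p^2 * h) - (f x - p^2 * G)) = 0"
    unfolding f2 f3 tp by (simp add: algebra_simps power2_eq_square)
  then show ?thesis
    using t f2 by (simp add: p_def)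
qed

lemma nonsym_t_affine_Jensen:
  assumes aff: "nonsym_t_affine_on t I f" and I: "is_interval I" and t: "0 < t" "t < 1"
    and k: "0 \<le> k" and ends: "x - k \<in> I" "x + k \<in> I"
  shows "f (x - k) + f (x + k) = 2 * f x"
proof -
  define p where "p = 1 - t"
  have p: "0 < p" "p < 1"
    using t by (auto simp: p_def)
  define g where "g s = f (x + s) - f x" for s
  have I_mem: "x + s \<in> I" if "-k \<le> s" "s \<le> k" for s
    using mem_is_interval_1_I[OF I ends] that by simp
  have x: "x \<in> I"
    using I_mem[of 0] k by simp
  have p2: "p^2 * s \<le> s" "p * s \<le> s" "0 \<le> p * s" if "0 \<le> s" for s
    using p that by (auto simp: mult_left_le_one_le power_le_one)
  have tn: "0 \<le> t^n * s" "t^n * s \<le> s" if "0 \<le> s" for n s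
    using t that by (auto simp: mult_left_le_one_le power_le_one)
  \<comment> \<open>The bound makes room on the right for the step \<open>s / p^2\<close> that a short reflection by \<open>s\<close> uses.\<close>
  have odd: "g (- s) = - g s" if s: "0 \<le> s" "s \<le> p^2 * k" for s
  proof -
    have "s / p^2 \<le> k" "0 \<le> s / p^2"
      using s p by (auto simp: field_simps)
    moreover from this have "x + s / p^2 \<in> I"
      using k by (intro I_mem) simp_all
    moreover have "x - s \<in> I"
      using I_mem[of "- s"] s k p2[OF k] by simp
    ultimately have "f (x - p^2 * (s / p^2)) + f (x + p^2 * (s / p^2)) = 2 * f x"
      using nonsym_t_affine_short_reflection[OF aff I t, of "s / p^2" x] p
      by (simp flip: p_def)
    then show ?thesis
      using p by (simp add: g_def)
  qed
  have right: "g (p * s) = p * g s" if "0 \<le> s" "s \<le> k" for s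
    using nonsym_t_affine_right_increment[OF aff x, of s] I_mem[of s] that
    by (simp add: g_def p_def)
  have right2: "g (p^2 * s) = p^2 * g s" if "0 \<le> s" "s \<le> k" for s
    using right[OF that] right[of "p * s"] p2[OF that(1)] that
    by (simp add: power2_eq_square mult.assoc)
  have left: "g (- (t^n * s)) = t^n * g (- s)" if "0 \<le> s" "s \<le> k" for s n
  proof (induction n)
    case (Suc n)
    have "g (- (t * (t^n * s))) = t * g (- (t^n * s))"
      using nonsym_t_affine_left_increment[OF aff x, of "t^n * s"] I_mem[of "- (t^n * s)"]
        tn[OF that(1), of n] that k by (simp add: g_def)
    then show ?case
      using Suc by (simp add: mult.assoc)
  qed simp
  obtain N where N: "t^N < p^2"
    using real_arch_pow_inv[of "p^2" t] p t by auto
  have small: "0 \<le> t^N * k" "t^N * k \<le> p^2 * k" "t^N * k \<le> k"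
    using tn[OF k] N k by (auto simp: mult_right_mono)
  have p2k: "0 \<le> p^2 * k" "p^2 * k \<le> k"
    using p2[OF k] k by auto
  have "p^2 * g (t^N * k) = g (t^N * (p^2 * k))"
    using right2[of "t^N * k"] small by (simp add: mult.left_commute)
  also have "\<dots> = - g (- (t^N * (p^2 * k)))"
    using odd[of "t^N * (p^2 * k)"] tn[OF p2k(1), of N] by simp
  also have "\<dots> = t^N * g (p^2 * k)"
    using left[OF p2k, of N] odd[of "p^2 * k"] p2k by simp
  also have "\<dots> = p^2 * (t^N * g k)"
    using right2[of k] k by simp
  finally have "g (t^N * k) = t^N * g k"
    using p by simp
  moreover have "- g (t^N * k) = t^N * g (- k)"
    using odd[of "t^N * k"] small left[of k N] k by simp
  ultimately have "t^N * (g k + g (- k)) = 0"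
    by (simp add: algebra_simps)
  then show ?thesis
    using t by (simp add: g_def)
qed

theorem theorem2:
  fixes I :: "real set" and t :: real and f :: "real \<Rightarrow> real"
  assumes "is_interval I" and "open I" and "I \<noteq> {}"
    and "0 < t" and "t < 1"
    and "nonsym_t_affine_on t I f"
  shows "t_affine_on t I f"
proof -
  note aff = assms(6)
  have reversed: "f (t * b + (1 - t) * a) = t * f b + (1 - t) * f a"
    if ab: "a \<in> I" "b \<in> I" "a \<le> b" for a b
  proof -
    have Jensen: "f u + f v = 2 * f ((a + b) / 2)"
      if "u \<in> I" "v \<in> I" "u + v = a + b" for u v
    proof -
      have "f v + f u = 2 * f ((a + b) / 2)" if "u \<in> I" "v \<in> I" "u + v = a + b" "u \<le> v" for u v
      proof -
        have "(a + b) / 2 - (v - u) / 2 = u" "(a + b) / 2 + (v - u) / 2 = v"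
          unfolding that(3)[symmetric] by (simp_all flip: diff_divide_distrib add_divide_distrib)
        then show ?thesis
          using nonsym_t_affine_Jensen[OF aff assms(1,4,5), of "(v - u) / 2" "(a + b) / 2"] that
          by simp
      qed
      from this[of u v] this[of v u] that show ?thesis
        by linarith
    qed
    have conv: "convex I"
      using assms(1) by (simp add: is_interval_convex)
    have "t * a + (1 - t) * b \<in> I" "t * b + (1 - t) * a \<in> I"
      using convexD[OF conv ab(1,2), of t "1 - t"] convexD[OF conv ab(2,1), of t "1 - t"] assms(4,5)
      by simp_all
    then have "f (t * a + (1 - t) * b) + f (t * b + (1 - t) * a) = f a + f b"
      using Jensen[of "t * a + (1 - t) * b" "t * b + (1 - t) * a"] Jensen[of a b] ab
      by (simp add: algebra_simps)
    then show ?thesis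
      using nonsym_t_affine_onD[OF aff ab] by (simp add: algebra_simps)
  qed
  show ?thesis
    unfolding t_affine_on_def
    using nonsym_t_affine_onD[OF aff] reversed by (meson linear)
qed

end
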